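(* Let $\mathcal{H}$ be a real Hilbert space and let $T:\mathcal{H}\to\mathcal{H}$ be a bounded linear operator. Then: (i) If $T$ is isometric and self-adjoint, then $\mathrm{P}_{\operatorname{Fix}T}=\frac12(\mathrm{Id}+T)$ and $\mathrm{P}_{(\operatorname{Fix}T)^\perp}=\frac12(\mathrm{Id}-T)$. (ii) $T$ is isometric and self-adjoint if and only if $T=\mathrm{R}_U$ for some closed linear subspace $U$ of $\mathcal{H}$.
   Context: $T$ is isometric if $\|Tx-Ty\|=\|x-y\|$ for all $x,y\in\mathcal{H}$. $\operatorname{Fix}T=\{x:Tx=x\}$. $\mathrm{P}_C$ is the projector (best approximation operator) onto $C$, and $\mathrm{R}_C=2\mathrm{P}_C-\mathrm{Id}$ is the reflector associated with $C$. $C^\perp$ is the orthogonal complement of $C$. *)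

theory Defs
  imports "HOL-Analysis.Analysis"
begin

text \<open>
  A real Hilbert space is a type of sort \<open>{real_inner, complete_space}\<close>.
\<close>

definition isometric :: "('a::real_normed_vector \<Rightarrow> 'b::real_normed_vector) \<Rightarrow> bool"
  where "isometric T \<longleftrightarrow> (\<forall>x y. norm (T x - T y) = norm (x - y))"

text \<open>
  The library's \<open>adjoint\<close> is a Hilbert choice among the maps \<open>f'\<close> with
  \<open>f x \<bullet> y = x \<bullet> f' y\<close> for all \<open>x\<close> and \<open>y\<close>. For a bounded linear operator on a
  Hilbert space such a map exists (Riesz) and is unique.
\<close>

definition self_adjoint :: "('a::real_inner \<Rightarrow> 'a) \<Rightarrow> bool"
  where "self_adjoint T \<longleftrightarrow> adjoint T = T"

definition Fix :: "('a \<Rightarrow> 'a) \<Rightarrow> 'a set"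
  where "Fix T = {x. T x = x}"

text \<open>
  The library's \<open>closest_point\<close> requires the sort \<open>heine_borel\<close>, which restricts it to
  finite-dimensional spaces, so the best approximation operator is defined here. The description
  denotes when \<open>C\<close> is nonempty, closed and convex and the space is complete, in particular for
  every closed linear subspace of a Hilbert space; otherwise the value may be unspecified.
\<close>

definition projector :: "'a::real_inner set \<Rightarrow> 'a \<Rightarrow> 'a"
  where "projector C x = (THE p. p \<in> C \<and> (\<forall>y\<in>C. norm (x - p) \<le> norm (x - y)))"

definition reflector :: "'a::real_inner set \<Rightarrow> 'a \<Rightarrow> 'a"
  where "reflector C x = 2 *\<^sub>R projector C x - x"

end

theory Submission
  imports Defs
begin

text \<open>
  A bounded linear operator on a Hilbert space has an adjoint by the Riesz representation theorem,
  so \<^const>\<open>self_adjoint\<close> really is the symmetry \<open>T x \<bullet> y = x \<bullet> T y\<close>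
  (\<open>self_adjoint_iff_symmetric\<close>). A linear isometry preserves inner products; together with
  symmetry this makes \<open>T\<close> an involution. Every \<open>x\<close> is then the sum of \<open>(x + T x) / 2\<close>, which \<open>T\<close>
  fixes, and \<open>(x - T x) / 2\<close>, which is orthogonal to every fixed point. By the Pythagorean
  theorem an orthogonal splitting of this kind determines both projectors
  (\<open>projector_eqI\<close>), which gives the two formulas and \<open>T = reflector (Fix T)\<close>.

  Conversely, every point splits as \<open>x = p + (x - p)\<close> along a closed subspace \<open>U\<close>, with
  \<open>p \<in> U\<close> and \<open>x - p\<close> orthogonal to \<open>U\<close> (\<open>orthogonal_decomposition\<close>). The reflector flips the
  sign of the second summand, an operation that changes no norm and is symmetric.

  Both Riesz and the converse rest on the existence of best approximations in a closed convex set,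
  the one place where completeness enters (\<open>nearest_point_exists\<close>).
\<close>

section \<open>Best approximation and orthogonal decomposition\<close>

text \<open>
  By the parallelogram identity, two points of \<open>C\<close> that are both nearly optimal have a midpoint
  that would be too close to \<open>x\<close> unless they are near each other. The nested sets of nearly
  optimal points thus have vanishing diameter, and completeness gives them a common point.
\<close>

lemma nearest_point_exists:
  fixes C :: "'a::{real_inner, complete_space} set"
  assumes "closed C" "convex C" "C \<noteq> {}"
  obtains p where "p \<in> C" "\<And>y. y \<in> C \<Longrightarrow> norm (x - p) \<le> norm (x - y)"
proof -
  define D where "D = (INF y\<in>C. (norm (x - y))\<^sup>2)"
  define S where "S n = {y \<in> C. (norm (x - y))\<^sup>2 \<le> D + 1 / real (Suc n)}" for n
  have bdd: "bdd_below ((\<lambda>y. (norm (x - y))\<^sup>2) ` C)"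
    by (rule bdd_belowI[of _ 0]) auto
  have D_le: "D \<le> (norm (x - y))\<^sup>2" if "y \<in> C" for y
    unfolding D_def by (rule cINF_lower[OF bdd that])
  \<comment> \<open>each of the two points contributes twice its slack \<open>1 / Suc n\<close>\<close>
  have close: "(dist y z)\<^sup>2 \<le> 4 / real (Suc n)" if "y \<in> S n" "z \<in> S n" for y z n
  proof -
    have "(1/2) *\<^sub>R y + (1/2) *\<^sub>R z \<in> C"
      using that by (intro convexD[OF \<open>convex C\<close>]) (auto simp: S_def)
    from D_le[OF this] have "4 * D \<le> 4 * (norm (x - ((1/2) *\<^sub>R y + (1/2) *\<^sub>R z)))\<^sup>2"
      by simp
    moreover have "(dist y z)\<^sup>2 + 4 * (norm (x - ((1/2) *\<^sub>R y + (1/2) *\<^sub>R z)))\<^sup>2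
        = 2 * (norm (x - y))\<^sup>2 + 2 * (norm (x - z))\<^sup>2"
      by (simp add: dist_norm power2_norm_eq_inner inner_simps inner_commute algebra_simps)
    ultimately show ?thesis using that by (simp add: S_def)
  qed
  have "\<exists>p. \<forall>n. p \<in> S n"
  proof (rule decreasing_closed_nest[of S])
    show "closed (S n)" for n
    proof -
      have "S n = C \<inter> {y. (norm (x - y))\<^sup>2 \<le> D + 1 / real (Suc n)}" by (auto simp: S_def)
      then show ?thesis
        using \<open>closed C\<close> by (auto intro!: closed_Int closed_Collect_le continuous_intros)
    qed
    show "S n \<noteq> {}" for n
    proof -
      have "D < D + 1 / real (Suc n)" by simp
      then obtain y where "y \<in> C" "(norm (x - y))\<^sup>2 < D + 1 / real (Suc n)"
        using cINF_less_iff[OF \<open>C \<noteq> {}\<close> bdd] unfolding D_def by blast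
      then show ?thesis unfolding S_def by fastforce
    qed
    show "S n \<subseteq> S m" if "m \<le> n" for m n
    proof -
      have "1 / real (Suc n) \<le> 1 / real (Suc m)" using that by (simp add: frac_le)
      then show ?thesis unfolding S_def by auto
    qed
    show "\<exists>n. \<forall>y\<in>S n. \<forall>z\<in>S n. dist y z < e" if "e > 0" for e
    proof -
      obtain n where "4 / e\<^sup>2 < real n" using reals_Archimedean2 by blast
      then have "4 < e\<^sup>2 * real n" using \<open>e > 0\<close> by (simp add: field_simps)
      also have "\<dots> \<le> e\<^sup>2 * real (Suc n)" by (intro mult_left_mono) auto
      finally have "4 / real (Suc n) < e\<^sup>2" by (simp add: field_simps)
      then have "dist y z < e" if "y \<in> S n" "z \<in> S n" for y z
        using close[OF that] \<open>e > 0\<close> by (intro power2_less_imp_less[of _ e]) auto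
      then show ?thesis by blast
    qed
  qed blast
  then obtain p where p: "\<And>n. p \<in> S n" by blast
  have "(norm (x - p))\<^sup>2 \<le> D"
  proof (rule field_le_epsilon)
    fix e :: real assume "0 < e"
    then obtain n where "inverse (real (Suc n)) < e" using reals_Archimedean by blast
    then show "(norm (x - p))\<^sup>2 \<le> D + e" using p[of n] by (simp add: S_def inverse_eq_divide)
  qed
  then have "norm (x - p) \<le> norm (x - y)" if "y \<in> C" for y
    using D_le[OF that] by (rule power2_le_imp_le[OF order_trans]) simp
  then show thesis using p[of 0] that by (auto simp: S_def)
qed

text \<open>
  The nearest point \<open>p\<close> works: were \<open>(x - p) \<bullet> u\<close> nonzero for some \<open>u \<in> U\<close>, moving from \<open>p\<close> by
  the component of \<open>x - p\<close> along \<open>u\<close> would stay in \<open>U\<close> and come strictly closer to \<open>x\<close>.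
\<close>

lemma orthogonal_decomposition:
  fixes U :: "'a::{real_inner, complete_space} set"
  assumes "closed U" "subspace U"
  obtains p where "p \<in> U" "x - p \<in> orthogonal_comp U"
proof -
  obtain p where p: "p \<in> U" "\<And>y. y \<in> U \<Longrightarrow> norm (x - p) \<le> norm (x - y)"
    using nearest_point_exists[OF \<open>closed U\<close>] assms subspace_imp_convex subspace_0 by blast
  have "(x - p) \<bullet> u = 0" if "u \<in> U" for u
  proof (cases "u = 0")
    case False
    define t where "t = ((x - p) \<bullet> u) / (u \<bullet> u)"
    have tu: "t * (u \<bullet> u) = (x - p) \<bullet> u" using False by (simp add: t_def)
    have "p + t *\<^sub>R u \<in> U" using p(1) that assms(2) by (simp add: subspace_add subspace_scale)
    from p(2)[OF this] have "(norm (x - p))\<^sup>2 \<le> (norm (x - (p + t *\<^sub>R u)))\<^sup>2"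
      by (intro power_mono) auto
    also have "\<dots> = (norm (x - p))\<^sup>2 - 2 * t * ((x - p) \<bullet> u) + t * (t * (u \<bullet> u))"
      by (simp add: power2_norm_eq_inner inner_simps inner_commute algebra_simps)
    also have "\<dots> = (norm (x - p))\<^sup>2 - t * t * (u \<bullet> u)"
      by (simp add: tu[symmetric])
    finally have "t * t * (u \<bullet> u) \<le> 0" by simp
    moreover have "u \<bullet> u > 0" using False by simp
    ultimately have "t * t \<le> 0" by (simp add: mult_le_0_iff)
    then have "t = 0" by (auto simp: mult_le_0_iff)
    then show ?thesis using tu by simp
  qed simp
  then have "x - p \<in> orthogonal_comp U"
    by (simp add: orthogonal_comp_def orthogonal_def inner_commute)
  with p(1) show thesis by (rule that)
qed

text \<open>
  For \<open>y \<in> U\<close> the vectors \<open>x - p\<close> and \<open>p - y\<close> are orthogonal, so the Pythagorean theorem makes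
  \<open>p\<close> the only minimizer.
\<close>

lemma projector_eqI:
  assumes "subspace U" "p \<in> U" "x - p \<in> orthogonal_comp U"
  shows "projector U x = p"
  unfolding projector_def
proof (rule the_equality)
  have pyth: "(norm (x - y))\<^sup>2 = (norm (x - p))\<^sup>2 + (norm (p - y))\<^sup>2" if "y \<in> U" for y
  proof -
    have "p - y \<in> U" using assms that by (simp add: subspace_diff)
    then have "(p - y) \<bullet> (x - p) = 0"
      using assms(3) by (simp add: orthogonal_comp_def orthogonal_def)
    then show ?thesis
      by (simp add: power2_norm_eq_inner inner_simps inner_commute algebra_simps)
  qed
  show "p \<in> U \<and> (\<forall>y\<in>U. norm (x - p) \<le> norm (x - y))"
  proof (intro conjI ballI)
    fix y assume "y \<in> U"
    then have "(norm (x - p))\<^sup>2 \<le> (norm (x - y))\<^sup>2" by (subst pyth[of y]) auto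
    then show "norm (x - p) \<le> norm (x - y)" by (rule power2_le_imp_le) simp
  qed fact
  fix q assume q: "q \<in> U \<and> (\<forall>y\<in>U. norm (x - q) \<le> norm (x - y))"
  then have "(norm (x - q))\<^sup>2 \<le> (norm (x - p))\<^sup>2"
    using \<open>p \<in> U\<close> by (intro power_mono) auto
  with pyth[of q] q have "(norm (p - q))\<^sup>2 \<le> 0" by simp
  then show "q = p" by simp
qed

section \<open>The adjoint of a bounded operator\<close>

text \<open>
  The kernel of \<open>f\<close> is a closed subspace of codimension at most one, so a vector \<open>z\<close> orthogonal
  to it and outside it represents \<open>f\<close> up to a scalar.
\<close>

lemma Riesz_representation:
  fixes f :: "'a::{real_inner, complete_space} \<Rightarrow> real"
  assumes "bounded_linear f"
  obtains a where "\<And>x. f x = x \<bullet> a"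
proof (cases "\<forall>x. f x = 0")
  case True
  then show thesis using that[of 0] by simp
next
  case False
  interpret f: bounded_linear f by fact
  define K where "K = {x. f x = 0}"
  have "closed K" unfolding K_def
    by (intro closed_Collect_eq continuous_intros f.continuous_on)
  moreover have "subspace K"
    by (auto simp: K_def subspace_def f.add f.scaleR f.zero)
  moreover obtain x0 where "f x0 \<noteq> 0" using False by blast
  ultimately obtain p where p: "p \<in> K" "x0 - p \<in> orthogonal_comp K"
    using orthogonal_decomposition by metis
  define z where "z = x0 - p"
  have fz: "f z \<noteq> 0" using p(1) \<open>f x0 \<noteq> 0\<close> by (simp add: z_def K_def f.diff)
  then have "z \<noteq> 0" using f.zero by auto
  have "f x = x \<bullet> ((f z / (z \<bullet> z)) *\<^sub>R z)" for x
  proof -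
    have "x - (f x / f z) *\<^sub>R z \<in> K" using fz by (simp add: K_def f.diff f.scaleR)
    then have "(x - (f x / f z) *\<^sub>R z) \<bullet> z = 0"
      using p(2) by (simp add: z_def orthogonal_comp_def orthogonal_def)
    then have "x \<bullet> z = f x / f z * (z \<bullet> z)" by (simp add: inner_simps)
    then show ?thesis using fz \<open>z \<noteq> 0\<close> by simp
  qed
  then show thesis by (rule that)
qed

text \<open>
  Since \<^const>\<open>adjoint\<close> is a choice, \<open>adjoint T = T\<close> says something about inner products only
  once Riesz, applied to \<open>x \<mapsto> T x \<bullet> y\<close> for each \<open>y\<close>, supplies a map to choose.
\<close>

lemma self_adjoint_iff_symmetric:
  fixes T :: "'a::{real_inner, complete_space} \<Rightarrow> 'a"
  assumes "bounded_linear T"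
  shows "self_adjoint T \<longleftrightarrow> (\<forall>x y. T x \<bullet> y = x \<bullet> T y)"
proof
  assume "self_adjoint T"
  have "\<exists>a. \<forall>x. T x \<bullet> y = x \<bullet> a" for y
  proof -
    have "bounded_linear (\<lambda>x. T x \<bullet> y)"
      using assms by (rule bounded_linear_compose[OF bounded_linear_inner_left])
    then show ?thesis using Riesz_representation by metis
  qed
  then have "\<exists>T'. \<forall>x y. T x \<bullet> y = x \<bullet> T' y" by metis
  then have "\<forall>x y. T x \<bullet> y = x \<bullet> adjoint T y"
    unfolding adjoint_def by (rule someI_ex)
  then show "\<forall>x y. T x \<bullet> y = x \<bullet> T y"
    using \<open>self_adjoint T\<close> by (simp add: self_adjoint_def)
next
  assume "\<forall>x y. T x \<bullet> y = x \<bullet> T y"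
  then show "self_adjoint T"
    unfolding self_adjoint_def by (rule adjoint_unique)
qed

section \<open>Symmetric isometries and reflectors\<close>

text \<open>
  By polarization, \<open>T x \<bullet> T y = x \<bullet> y\<close>; moving one \<open>T\<close> across by symmetry shows that
  \<open>T (T x) - x\<close> is orthogonal to every \<open>y\<close>.
\<close>

lemma symmetric_isometry_involutive:
  fixes T :: "'a::real_inner \<Rightarrow> 'a"
  assumes "linear T" "isometric T" and sym: "\<And>x y. T x \<bullet> y = x \<bullet> T y"
  shows "T (T x) = x"
proof -
  have norm_T: "norm (T z) = norm z" for z
    using assms(2)[unfolded isometric_def, rule_format, of z 0] linear_0[OF assms(1)] by simp
  have "T x \<bullet> T y = x \<bullet> y" for y
  proof -
    have "(norm (T x - T y))\<^sup>2 = (norm (x - y))\<^sup>2" using assms(2) by (simp add: isometric_def)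
    moreover have "T x \<bullet> T x = x \<bullet> x" "T y \<bullet> T y = y \<bullet> y"
      using norm_T by (simp_all only: flip: power2_norm_eq_inner)
    ultimately show ?thesis
      by (simp add: power2_norm_eq_inner inner_simps inner_commute)
  qed
  then have "(T (T x) - x) \<bullet> y = 0" for y
    by (simp add: inner_diff_left sym)
  from this[of "T (T x) - x"] show ?thesis by simp
qed

lemma subspace_Fix:
  assumes "linear T"
  shows "subspace (Fix T)"
  by (auto simp: subspace_def Fix_def linear_0[OF assms] linear_add[OF assms]
      linear_scale[OF assms])

lemma closed_Fix:
  fixes T :: "'a::real_normed_vector \<Rightarrow> 'a"
  assumes "bounded_linear T"
  shows "closed (Fix T)"
  unfolding Fix_def
  by (rule closed_Collect_eq[OF linear_continuous_on[OF assms] continuous_on_id])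

text \<open>
  As \<open>T\<close> is an involution, it swaps the two terms of \<open>x + T x\<close>; and symmetry gives
  \<open>u \<bullet> T x = T u \<bullet> x = u \<bullet> x\<close> for every fixed point \<open>u\<close>.
\<close>

lemma Fix_decomposition:
  fixes T :: "'a::real_inner \<Rightarrow> 'a"
  assumes "linear T" "isometric T" and sym: "\<And>x y. T x \<bullet> y = x \<bullet> T y"
  shows "(1/2) *\<^sub>R (x + T x) \<in> Fix T"
    and "(1/2) *\<^sub>R (x - T x) \<in> orthogonal_comp (Fix T)"
proof -
  show "(1/2) *\<^sub>R (x + T x) \<in> Fix T"
    using symmetric_isometry_involutive[OF assms]
    by (simp add: Fix_def linear_add[OF assms(1)] linear_scale[OF assms(1)] add.commute)
  have "u \<bullet> (x - T x) = 0" if "T u = u" for u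
    using sym[of u x] that by (simp add: inner_diff_right)
  then show "(1/2) *\<^sub>R (x - T x) \<in> orthogonal_comp (Fix T)"
    by (simp add: orthogonal_comp_def orthogonal_def Fix_def)
qed

lemma projector_Fix:
  fixes T :: "'a::real_inner \<Rightarrow> 'a"
  assumes "linear T" "isometric T" "\<And>x y. T x \<bullet> y = x \<bullet> T y"
  shows "projector (Fix T) x = (1/2) *\<^sub>R (x + T x)"
proof (rule projector_eqI)
  have "x - (1/2) *\<^sub>R (x + T x) = (1/2) *\<^sub>R (x - T x)"
    by (simp add: scaleR_right_distrib scaleR_right_diff_distrib diff_eq_eq flip: scaleR_left_distrib)
  then show "x - (1/2) *\<^sub>R (x + T x) \<in> orthogonal_comp (Fix T)"
    using Fix_decomposition(2)[OF assms] by simp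
qed (fact subspace_Fix[OF assms(1)] Fix_decomposition(1)[OF assms])+

lemma projector_orthogonal_comp_Fix:
  fixes T :: "'a::real_inner \<Rightarrow> 'a"
  assumes "linear T" "isometric T" "\<And>x y. T x \<bullet> y = x \<bullet> T y"
  shows "projector (orthogonal_comp (Fix T)) x = (1/2) *\<^sub>R (x - T x)"
proof (rule projector_eqI)
  have "x - (1/2) *\<^sub>R (x - T x) = (1/2) *\<^sub>R (x + T x)"
    by (simp add: scaleR_right_distrib scaleR_right_diff_distrib diff_eq_eq flip: scaleR_left_distrib)
  then show "x - (1/2) *\<^sub>R (x - T x) \<in> orthogonal_comp (orthogonal_comp (Fix T))"
    using Fix_decomposition(1)[OF assms] orthogonal_comp_subset by auto
qed (fact subspace_orthogonal_comp Fix_decomposition(2)[OF assms])+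

lemma
  fixes U :: "'a::{real_inner, complete_space} set"
  assumes "closed U" "subspace U"
  shows projector_in: "projector U x \<in> U"
    and inner_projector_right: "y \<in> U \<Longrightarrow> y \<bullet> projector U x = y \<bullet> x"
proof -
  obtain p where p: "p \<in> U" "x - p \<in> orthogonal_comp U"
    using orthogonal_decomposition[OF assms] by metis
  then have "projector U x = p" by (intro projector_eqI assms)
  with p show "projector U x \<in> U" "y \<in> U \<Longrightarrow> y \<bullet> projector U x = y \<bullet> x"
    by (auto simp: orthogonal_comp_def orthogonal_def inner_diff_right)
qed

text \<open>
  Only the components along \<open>U\<close> meet: both \<open>projector U x \<bullet> y\<close> and \<open>x \<bullet> projector U y\<close> equal
  \<open>projector U x \<bullet> projector U y\<close>.
\<close>

lemma inner_reflector_commute: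
  fixes U :: "'a::{real_inner, complete_space} set"
  assumes "closed U" "subspace U"
  shows "reflector U x \<bullet> y = x \<bullet> reflector U y"
proof -
  have "projector U x \<bullet> y = projector U x \<bullet> projector U y"
    using inner_projector_right projector_in assms by metis
  also have "\<dots> = x \<bullet> projector U y"
    using inner_projector_right projector_in assms by (metis inner_commute)
  finally show ?thesis by (simp add: reflector_def inner_simps)
qed

text \<open>
  With \<open>p = projector U x\<close>, expanding \<open>\<parallel>2p - x\<parallel>\<^sup>2\<close> leaves
  \<open>\<parallel>x\<parallel>\<^sup>2 + 4 (p \<bullet> p - p \<bullet> x)\<close>, whose last term vanishes because \<open>x - p\<close> is orthogonal to \<open>p\<close>.
\<close>

lemma norm_reflector:
  fixes U :: "'a::{real_inner, complete_space} set"
  assumes "closed U" "subspace U"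
  shows "norm (reflector U x) = norm x"
proof -
  have "projector U x \<bullet> projector U x = projector U x \<bullet> x"
    using inner_projector_right projector_in assms by metis
  then show ?thesis
    by (simp add: norm_eq reflector_def inner_simps inner_commute)
qed

theorem theorem3p14:
  fixes T :: "'a::{real_inner, complete_space} \<Rightarrow> 'a"
  assumes "bounded_linear T"
  shows "(isometric T \<and> self_adjoint T \<longrightarrow>
            projector (Fix T) = (\<lambda>x. (1/2) *\<^sub>R (x + T x)) \<and>
            projector (orthogonal_comp (Fix T)) = (\<lambda>x. (1/2) *\<^sub>R (x - T x))) \<and>
         (isometric T \<and> self_adjoint T \<longleftrightarrow>
            (\<exists>U. closed U \<and> subspace U \<and> T = reflector U))"
proof -
  have lin: "linear T" using assms by (rule bounded_linear.linear)
  note sa = self_adjoint_iff_symmetric[OF assms]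
  have projectors: "projector (Fix T) = (\<lambda>x. (1/2) *\<^sub>R (x + T x))"
      "projector (orthogonal_comp (Fix T)) = (\<lambda>x. (1/2) *\<^sub>R (x - T x))"
    if "isometric T" "self_adjoint T"
  proof -
    have sym: "T x \<bullet> y = x \<bullet> T y" for x y using that(2) sa by blast
    show "projector (Fix T) = (\<lambda>x. (1/2) *\<^sub>R (x + T x))"
      by (rule ext) (rule projector_Fix[OF lin that(1) sym])
    show "projector (orthogonal_comp (Fix T)) = (\<lambda>x. (1/2) *\<^sub>R (x - T x))"
      by (rule ext) (rule projector_orthogonal_comp_Fix[OF lin that(1) sym])
  qed
  moreover have "\<exists>U. closed U \<and> subspace U \<and> T = reflector U"
    if "isometric T" "self_adjoint T"
  proof (intro exI conjI)
    show "T = reflector (Fix T)" by (simp add: fun_eq_iff reflector_def projectors(1)[OF that])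
  qed (fact closed_Fix[OF assms] subspace_Fix[OF lin])+
  moreover have "isometric T \<and> self_adjoint T" if "closed U" "subspace U" "T = reflector U" for U
  proof
    show "isometric T"
      using norm_reflector[OF that(1,2)]
      unfolding isometric_def linear_diff[OF lin, symmetric] that(3)[symmetric] by blast
    show "self_adjoint T"
      using inner_reflector_commute[OF that(1,2)]
      unfolding sa that(3)[symmetric] by blast
  qed
  ultimately show ?thesis by blast
qed

end
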